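(* Let $S$ be an inverse semigroup and $N$ a normal inverse subsemigroup of $S$. Then the quotient set $S/\!/N = S/{\simeq_N}$ is an ordered groupoid, with the following structure: (a) the identities are the classes $[e]_N$ where $e \in E(S)$, and a class $[s]_N$ has domain $[ss^{-1}]_N$, range $[s^{-1}s]_N$, and inverse $[s^{-1}]_N$; (b) as a poset, $E(S/\!/N)$ is isomorphic to $N/\mathcal{J}_N$, the poset of $\mathcal{J}$-classes of the semigroup $N$; (c) if $s,t \in S$ and $s^{-1}s \simeq_N tt^{-1}$, then there exists $a \in N$ with $aa^{-1} \leq s^{-1}s$ and $a^{-1}a = tt^{-1}$, and the composition of $[s]_N$ and $[t]_N$ is then defined as $[sat]_N$; (d) the ordering $\leq_N$ of $\simeq_N$-classes is given by: $[s]_N \leq_N [t]_N$ if and only if there exist $a,b \in N$ such that the trace product $a \cdot s \cdot b$ is defined and $a \cdot s \cdot b \leq t$.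
   Context: $S$ is an inverse semigroup with semilattice of idempotents $E(S)$ and natural partial order $\leq$. A product $st$ is called a trace product, written $s\cdot t$, when $s^{-1}s = tt^{-1}$; writing $a\cdot s\cdot b$ asserts that $a^{-1}a = ss^{-1}$ and $s^{-1}s = bb^{-1}$. An inverse subsemigroup $N$ of $S$ is normal if $E(N)=E(S)$ (i.e. $N$ is full) and $s^{-1}ns\in N$ for all $s\in S$, $n\in N$. For normal $N$, define $s\leq_N t$ iff there exist $a,b\in N$ with $a\cdot s\cdot b\leq t$, and $s\simeq_N t$ iff $s\leq_N t$ and $t\leq_N s$; $\leq_N$ is a preorder and $\simeq_N$ is an equivalence relation. $[s]_N$ is the $\simeq_N$-class of $s$. $\mathcal{J}_N$ is Green's $\mathcal J$-relation of the semigroup $N$, and $N/\mathcal{J}_N$ carries the usual $\mathcal{J}$-order. A groupoid is a small category in which every morphism is invertible, regarded as its set of morphisms with partial composition; the composition $gh$ is defined iff the range $g^{-1}g$ of $g$ equals the domain $hh^{-1}$ of $h$; $E(G)$ is the set of identities of $G$. An ordered groupoid is a groupoid $G$ with a partial order $\leq$ such that: (OG1) $g\leq h$ implies $g^{-1}\leq h^{-1}$; (OG2) if $g_1\leq g_2$, $h_1\leq h_2$ and the compositions $g_1h_1$, $g_2h_2$ are defined then $g_1h_1\leq g_2h_2$; (OG3) if $g\in G$ and $x\in E(G)$ with $x\leq gg^{-1}$, there is a unique element $(x|g)$ with $(x|g)(x|g)^{-1}=x$ and $(x|g)\leq g$. *)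

theory Defs
  imports Main
begin
class inverse_semigroup = semigroup_mult +
  assumes ex1_semigroup_inverse: "\<exists>!y. x * y * x = x \<and> y * x * y = y"

definition sinv :: "'a::inverse_semigroup \<Rightarrow> 'a"  ("_\<inverse>" [1000] 999)
  where "s\<inverse> = (THE y. s * y * s = s \<and> y * s * y = y)"

definition idempotents :: "'a::inverse_semigroup set"
  where "idempotents = {e. e * e = e}"

definition natural_le :: "'a::inverse_semigroup \<Rightarrow> 'a \<Rightarrow> bool"  (infix "\<preceq>" 50)
  where "s \<preceq> t \<longleftrightarrow> (\<exists>e \<in> idempotents. s = e * t)"

text \<open>The trace product $s \cdot t$ is just the product, when it is defined.\<close>

definition trace_defined :: "'a::inverse_semigroup \<Rightarrow> 'a \<Rightarrow> bool"
  where "trace_defined s t \<longleftrightarrow> s\<inverse> * s = t * t\<inverse>"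

definition inverse_subsemigroup :: "'a::inverse_semigroup set \<Rightarrow> bool"
  where "inverse_subsemigroup N \<longleftrightarrow>
    (\<forall>m \<in> N. \<forall>n \<in> N. m * n \<in> N) \<and> (\<forall>n \<in> N. n\<inverse> \<in> N)"

definition normal_inverse_subsemigroup :: "'a::inverse_semigroup set \<Rightarrow> bool"
  where "normal_inverse_subsemigroup N \<longleftrightarrow>
    inverse_subsemigroup N \<and>
    {n \<in> N. n * n = n} = idempotents \<and>
    (\<forall>s. \<forall>n \<in> N. s\<inverse> * n * s \<in> N)"

definition le_mod :: "'a::inverse_semigroup set \<Rightarrow> 'a \<Rightarrow> 'a \<Rightarrow> bool"
  where "le_mod N s t \<longleftrightarrow>
    (\<exists>a \<in> N. \<exists>b \<in> N. trace_defined a s \<and> trace_defined s b \<and> a * s * b \<preceq> t)"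

definition eq_mod :: "'a::inverse_semigroup set \<Rightarrow> 'a \<Rightarrow> 'a \<Rightarrow> bool"
  where "eq_mod N s t \<longleftrightarrow> le_mod N s t \<and> le_mod N t s"

definition class_mod :: "'a::inverse_semigroup set \<Rightarrow> 'a \<Rightarrow> 'a set"
  where "class_mod N s = {(x, y). eq_mod N x y} `` {s}"

definition quotient_mod :: "'a::inverse_semigroup set \<Rightarrow> 'a set set"
  where "quotient_mod N = UNIV // {(x, y). eq_mod N x y}"

text \<open>
  Ideals and Green's J-relation are taken in \<open>N\<close>, regarded as a semigroup in its own right:
  \<open>principal_ideal N x\<close> is $N^1 x N^1$.
\<close>

definition principal_ideal :: "'a::semigroup_mult set \<Rightarrow> 'a \<Rightarrow> 'a set"
  where "principal_ideal N x =
    {x} \<union> {m * x | m. m \<in> N} \<union> {x * n | n. n \<in> N} \<union> {m * x * n | m n. m \<in> N \<and> n \<in> N}"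

definition green_J :: "'a::semigroup_mult set \<Rightarrow> ('a \<times> 'a) set"
  where "green_J N = {(x, y). x \<in> N \<and> y \<in> N \<and> principal_ideal N x = principal_ideal N y}"

definition J_class_le :: "'a::semigroup_mult set \<Rightarrow> 'a set \<Rightarrow> 'a set \<Rightarrow> bool"
  where "J_class_le N X Y \<longleftrightarrow> (\<forall>x \<in> X. \<forall>y \<in> Y. principal_ideal N x \<subseteq> principal_ideal N y)"

text \<open>
  A groupoid is given by its set \<open>G\<close> of morphisms, objects being represented by their
  identities. The parameters \<open>d\<close>, \<open>r\<close>, \<open>i\<close> give domain, range and inverse; their values
  outside \<open>G\<close> are irrelevant. Composition is partial, with the domain of \<open>g\<close> written
  on the left: \<open>c g h\<close> is defined iff \<open>r g = d h\<close>.
\<close>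

locale groupoid =
  fixes G :: "'g set"
    and d r i :: "'g \<Rightarrow> 'g"
    and c :: "'g \<Rightarrow> 'g \<Rightarrow> 'g option"
  assumes dom_in: "g \<in> G \<Longrightarrow> d g \<in> G"
    and ran_in: "g \<in> G \<Longrightarrow> r g \<in> G"
    and dom_dom: "g \<in> G \<Longrightarrow> d (d g) = d g"
    and ran_dom: "g \<in> G \<Longrightarrow> r (d g) = d g"
    and dom_ran: "g \<in> G \<Longrightarrow> d (r g) = r g"
    and ran_ran: "g \<in> G \<Longrightarrow> r (r g) = r g"
    and comp_defined: "g \<in> G \<Longrightarrow> h \<in> G \<Longrightarrow> c g h \<noteq> None \<longleftrightarrow> r g = d h"
    and comp_closed: "g \<in> G \<Longrightarrow> h \<in> G \<Longrightarrow> c g h = Some k \<Longrightarrow> k \<in> G \<and> d k = d g \<and> r k = r h"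
    and comp_assoc: "f \<in> G \<Longrightarrow> g \<in> G \<Longrightarrow> h \<in> G \<Longrightarrow> c f g = Some k \<Longrightarrow> c g h = Some l \<Longrightarrow>
      c k h = c f l"
    and comp_dom: "g \<in> G \<Longrightarrow> c (d g) g = Some g"
    and comp_ran: "g \<in> G \<Longrightarrow> c g (r g) = Some g"
    and inv_in: "g \<in> G \<Longrightarrow> i g \<in> G"
    and comp_inv_right: "g \<in> G \<Longrightarrow> c g (i g) = Some (d g)"
    and comp_inv_left: "g \<in> G \<Longrightarrow> c (i g) g = Some (r g)"

definition identities :: "'g set \<Rightarrow> ('g \<Rightarrow> 'g) \<Rightarrow> 'g set"
  where "identities G d = {x \<in> G. d x = x}"

locale ordered_groupoid = groupoid G d r i c
  for G :: "'g set" and d r i :: "'g \<Rightarrow> 'g" and c :: "'g \<Rightarrow> 'g \<Rightarrow> 'g option" +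
  fixes le :: "'g \<Rightarrow> 'g \<Rightarrow> bool"
  assumes le_refl: "reflp_on G le"
    and le_antisym: "antisymp_on G le"
    and le_trans: "transp_on G le"
    and OG1: "g \<in> G \<Longrightarrow> h \<in> G \<Longrightarrow> le g h \<Longrightarrow> le (i g) (i h)"
    and OG2: "g1 \<in> G \<Longrightarrow> g2 \<in> G \<Longrightarrow> h1 \<in> G \<Longrightarrow> h2 \<in> G \<Longrightarrow> le g1 g2 \<Longrightarrow> le h1 h2 \<Longrightarrow>
      c g1 h1 = Some k1 \<Longrightarrow> c g2 h2 = Some k2 \<Longrightarrow> le k1 k2"
    and OG3: "g \<in> G \<Longrightarrow> x \<in> identities G d \<Longrightarrow> le x (d g) \<Longrightarrow>
      \<exists>!k. k \<in> G \<and> d k = x \<and> le k g"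

end

theory Submission
  imports Defs
begin

text \<open>
  The relation \<open>s \<le>\<^sub>N t\<close> holds iff \<open>s \<in> N t N\<close>; this replaces trace products by plain
  factorizations and makes reflexivity, transitivity and compatibility with inverses immediate.
  If \<open>a \<in> N\<close> with \<open>a a\<inverse> \<preceq> s\<inverse> s\<close> and \<open>a\<inverse> a = t t\<inverse>\<close>, then
  \<open>s n t = (s n a\<inverse> s\<inverse>) (s a t)\<close> for every \<open>n \<in> N\<close>, and the first factor lies in \<open>N\<close>.
  So \<open>[s a t]\<close> is the largest class that meets \<open>s N t\<close>. This description does not mention \<open>a\<close>,
  and it yields well-definedness, monotonicity and associativity of the composition.
  For the identities, the class of an idempotent \<open>e\<close> is contained in \<open>N\<close>, so it is literally the
  \<open>\<J>\<close>-class of \<open>e\<close> in \<open>N\<close>.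
\<close>

text \<open>The converse of a relation has the same notation as \<^const>\<open>sinv\<close>; keeping both makes the number
  of parses exponential in the number of inverses.\<close>

unbundle no converse_syntax

section \<open>Inverse semigroups\<close>

lemma sinv_props:
  fixes s :: "'a::inverse_semigroup"
  shows "s * s\<inverse> * s = s" and "s\<inverse> * s * s\<inverse> = s\<inverse>"
  using theI'[OF ex1_semigroup_inverse[of s]] unfolding sinv_def by auto

lemma sinv_unique:
  fixes s :: "'a::inverse_semigroup"
  assumes "s * y * s = s" "y * s * y = y"
  shows "s\<inverse> = y"
  using ex1_semigroup_inverse[of s] sinv_props[of s] assms by blast

lemma sinv_cancel [simp]:
  fixes s :: "'a::inverse_semigroup"
  shows "s * (s\<inverse> * s) = s" "s\<inverse> * (s * s\<inverse>) = s\<inverse>"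
    "s * (s\<inverse> * (s * x)) = s * x" "s\<inverse> * (s * (s\<inverse> * x)) = s\<inverse> * x"
  using sinv_props[of s] by (simp_all add: mult.assoc[symmetric])

text \<open>The bracketing suits its use: once an idempotent is written as \<open>s * x\<close>, it
  is seen to be fixed on the left by \<open>s * s\<inverse>\<close>.\<close>

lemma dom_absorb: "s * s\<inverse> * (s * x) = s * x" for s :: "'a::inverse_semigroup"
  by (simp add: mult.assoc)

lemma sinv_sinv [simp]: "(s\<inverse>)\<inverse> = (s :: 'a::inverse_semigroup)"
  by (rule sinv_unique) (simp_all add: mult.assoc)

lemma sinv_idempotent: "e \<in> idempotents \<Longrightarrow> e\<inverse> = e"
  by (rule sinv_unique) (simp_all add: idempotents_def)

text \<open>The inverse \<open>x\<close> of \<open>e * f\<close> equals \<open>f * x * e\<close>,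
  since the latter is an inverse too; this form forces \<open>x\<close> to be idempotent. An
  idempotent is its own inverse, so \<open>e * f = x\<close>.\<close>

lemma idempotent_mult:
  fixes e f :: "'a::inverse_semigroup"
  assumes "e \<in> idempotents" "f \<in> idempotents"
  shows "e * f \<in> idempotents"
proof -
  define x where "x = (e * f)\<inverse>"
  have e: "e * e = e" "e * (e * z) = e * z" and f: "f * f = f" "f * (f * z) = f * z" for z
    using assms by (simp_all add: idempotents_def mult.assoc[symmetric])
  have x: "e * (f * (x * (e * f))) = e * f" "x * (e * (f * x)) = x"
    using sinv_props[of "e * f"] by (simp_all add: x_def mult.assoc)
  have x': "x * (e * (f * (x * z))) = x * z" for z
    using arg_cong[OF x(2), of "\<lambda>y. y * z"] by (simp add: mult.assoc)
  have fxe: "x = f * x * e"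
    unfolding x_def
    by (rule sinv_unique; fold x_def) (simp_all add: mult.assoc e f x x')
  have "x * x = (f * x * e) * (f * x * e)"
    using fxe by simp
  also have "\<dots> = f * x * e"
    by (simp add: mult.assoc x')
  finally have "x * x = x"
    using fxe by simp
  then have x_idem: "x \<in> idempotents"
    by (simp add: idempotents_def)
  then have "e * f = x"
    using sinv_idempotent[of x] by (simp add: x_def)
  then show ?thesis
    using x_idem by simp
qed

text \<open>As both products are idempotent, \<open>f * e\<close> is an inverse of
  \<open>e * f\<close>, which is its own inverse.\<close>

lemma idempotent_commute:
  fixes e f :: "'a::inverse_semigroup"
  assumes "e \<in> idempotents" "f \<in> idempotents"
  shows "e * f = f * e"
proof -
  have e: "e * (e * z) = e * z" and f: "f * (f * z) = f * z" for z
    using assms by (simp_all add: idempotents_def mult.assoc[symmetric])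
  have "e * (f * (e * f)) = e * f" "f * (e * (f * e)) = f * e"
    using idempotent_mult[OF assms] idempotent_mult[OF assms(2,1)]
    by (simp_all add: idempotents_def mult.assoc)
  then have "(e * f)\<inverse> = f * e"
    by (intro sinv_unique) (simp_all add: mult.assoc e f)
  then show ?thesis
    using sinv_idempotent[OF idempotent_mult[OF assms]] by simp
qed

lemma idempotent_mult_sinv [simp]:
  fixes s :: "'a::inverse_semigroup"
  shows "s * s\<inverse> \<in> idempotents" "s\<inverse> * s \<in> idempotents"
  by (simp_all add: idempotents_def mult.assoc)

lemma sinv_mult [simp]: "(s * t)\<inverse> = t\<inverse> * s\<inverse>" for s t :: "'a::inverse_semigroup"
proof (rule sinv_unique)
  have comm: "t * t\<inverse> * (s\<inverse> * s) = s\<inverse> * s * (t * t\<inverse>)"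
    by (rule idempotent_commute) simp_all
  have "s * t * (t\<inverse> * s\<inverse>) * (s * t) = s * (t * t\<inverse> * (s\<inverse> * s)) * t"
    by (simp add: mult.assoc)
  also have "\<dots> = s * t"
    unfolding comm by (simp add: mult.assoc)
  finally show "s * t * (t\<inverse> * s\<inverse>) * (s * t) = s * t" .
  have "t\<inverse> * s\<inverse> * (s * t) * (t\<inverse> * s\<inverse>) = t\<inverse> * (s\<inverse> * s * (t * t\<inverse>)) * s\<inverse>"
    by (simp add: mult.assoc)
  also have "\<dots> = t\<inverse> * s\<inverse>"
    unfolding comm[symmetric] by (simp add: mult.assoc)
  finally show "t\<inverse> * s\<inverse> * (s * t) * (t\<inverse> * s\<inverse>) = t\<inverse> * s\<inverse>" .
qed

lemma idempotent_conj:
  fixes s :: "'a::inverse_semigroup"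
  assumes "e \<in> idempotents"
  shows "s * e * s\<inverse> \<in> idempotents"
proof -
  have "s * e * s\<inverse> = s * e * (s * e)\<inverse>"
    using assms by (simp add: sinv_idempotent mult.assoc)
      (simp add: idempotents_def mult.assoc[symmetric])
  then show ?thesis
    by (metis idempotent_mult_sinv(1))
qed

text \<open>An idempotent on the right moves to the left:
  \<open>t * f = (t * f * t\<inverse>) * t\<close>, because \<open>f\<close> commutes with
  \<open>t\<inverse> * t\<close>.\<close>

lemma natural_le_mult_idempotent:
  fixes t :: "'a::inverse_semigroup"
  assumes "e \<in> idempotents" "f \<in> idempotents"
  shows "e * t * f \<preceq> t"
proof -
  have "t * f = t * (t\<inverse> * t * f)"
    by (simp add: mult.assoc)
  also have "t\<inverse> * t * f = f * (t\<inverse> * t)"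
    by (rule idempotent_commute) (use assms in simp_all)
  finally have "e * t * f = e * (t * f * t\<inverse>) * t"
    by (simp add: mult.assoc)
  then show ?thesis
    unfolding natural_le_def using assms idempotent_mult idempotent_conj by blast
qed

lemma natural_le_idempotentD:
  fixes e f :: "'a::inverse_semigroup"
  assumes "e \<preceq> f" "f \<in> idempotents"
  shows "e * f = e" "f * e = e"
proof -
  from assms obtain g where g: "g \<in> idempotents" "e = g * f"
    by (auto simp: natural_le_def)
  have ff: "f * f = f"
    using assms by (simp add: idempotents_def)
  then show "e * f = e"
    by (simp add: g mult.assoc)
  then show "f * e = e"
    using idempotent_commute[OF assms(2) idempotent_mult[OF g(1) assms(2)]] g by simp
qed

section \<open>The order and the composition on representatives\<close>

locale normal_subsemigroup =
  fixes N :: "'a::inverse_semigroup set"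
  assumes normal: "normal_inverse_subsemigroup N"
begin

lemma mult_mem: "m \<in> N \<Longrightarrow> n \<in> N \<Longrightarrow> m * n \<in> N"
  and sinv_mem: "n \<in> N \<Longrightarrow> n\<inverse> \<in> N"
  and idempotent_mem: "e \<in> idempotents \<Longrightarrow> e \<in> N"
  and conj_mem: "n \<in> N \<Longrightarrow> s\<inverse> * n * s \<in> N"
  using normal unfolding normal_inverse_subsemigroup_def inverse_subsemigroup_def by auto

lemma conj_mem': "n \<in> N \<Longrightarrow> s * n * s\<inverse> \<in> N"
  using conj_mem[of n "s\<inverse>"] by simp

lemmas mem_intros = mult_mem sinv_mem idempotent_mem conj_mem conj_mem'

lemma le_mod_iff: "le_mod N s t \<longleftrightarrow> (\<exists>a\<in>N. \<exists>b\<in>N. s = a * t * b)"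
proof
  assume "le_mod N s t"
  then obtain a b e where ab: "a \<in> N" "b \<in> N" "a\<inverse> * a = s * s\<inverse>" "s\<inverse> * s = b * b\<inverse>"
    and e: "e \<in> idempotents" "a * s * b = e * t"
    by (auto simp: le_mod_def trace_defined_def natural_le_def)
  \<comment> \<open>The trace conditions turn the domain and range idempotents of \<open>s\<close>
    into \<open>a\<inverse> * a\<close> and \<open>b * b\<inverse>\<close>, so that
    \<open>a * s * b = e * t\<close> can be solved for \<open>s\<close>.\<close>
  have "s = (s * s\<inverse>) * s * (s\<inverse> * s)"
    by (simp add: mult.assoc)
  also have "\<dots> = a\<inverse> * (a * s * b) * b\<inverse>"
    unfolding ab(3)[symmetric] ab(4) by (simp add: mult.assoc)
  also have "\<dots> = a\<inverse> * e * t * b\<inverse>"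
    unfolding e(2) by (simp add: mult.assoc)
  finally have "s = a\<inverse> * e * t * b\<inverse>" .
  moreover have "a\<inverse> * e \<in> N" "b\<inverse> \<in> N"
    using ab(1,2) e(1) by (simp_all add: mem_intros)
  ultimately show "\<exists>a\<in>N. \<exists>b\<in>N. s = a * t * b"
    by blast
next
  assume "\<exists>a\<in>N. \<exists>b\<in>N. s = a * t * b"
  then obtain x y where xy: "x \<in> N" "y \<in> N" "s = x * t * y"
    by blast
  \<comment> \<open>Cutting \<open>x\<inverse>\<close> and \<open>y\<inverse>\<close> down to the
    domain and range of \<open>s\<close> makes both products trace products, and
    \<open>a * s * b\<close> becomes \<open>t\<close> multiplied by an idempotent on each
    side.\<close>
  define a b where "a = x\<inverse> * (s * s\<inverse>)" and "b = (s\<inverse> * s) * y\<inverse>"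
  have xs: "x * (x\<inverse> * (s * z)) = s * z" and ys: "s * (y\<inverse> * (y * z)) = s * z" for z
    by (simp_all add: xy mult.assoc)
  have "a \<in> N" "b \<in> N"
    by (simp_all add: a_def b_def mem_intros xy(1,2))
  moreover have "trace_defined a s"
    by (simp add: trace_defined_def a_def mult.assoc xs)
  moreover have "trace_defined s b"
    by (simp add: trace_defined_def b_def mult.assoc ys)
  moreover have "a * s * b = (x\<inverse> * x) * t * (y * y\<inverse>)"
    by (simp add: a_def b_def mult.assoc) (simp add: xy mult.assoc)
  then have "a * s * b \<preceq> t"
    by (simp add: natural_le_mult_idempotent)
  ultimately show "le_mod N s t"
    by (auto simp: le_mod_def)
qed

section \<open>Preorder laws and behaviour on inverses, domains and ranges\<close>

lemma le_modI: "a \<in> N \<Longrightarrow> b \<in> N \<Longrightarrow> s = a * t * b \<Longrightarrow> le_mod N s t"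
  by (auto simp: le_mod_iff)

lemma le_modE:
  assumes "le_mod N s t"
  obtains a b where "a \<in> N" "b \<in> N" "s = a * t * b"
  using assms by (auto simp: le_mod_iff)

lemma le_mod_refl: "le_mod N s s"
  by (rule le_modI[of "s * s\<inverse>" "s\<inverse> * s"]) (simp_all add: mem_intros mult.assoc)

lemma le_mod_trans:
  assumes "le_mod N s t" "le_mod N t u"
  shows "le_mod N s u"
proof -
  obtain a b where ab: "a \<in> N" "b \<in> N" "s = a * t * b"
    using assms(1) by (rule le_modE)
  obtain p q where pq: "p \<in> N" "q \<in> N" "t = p * u * q"
    using assms(2) by (rule le_modE)
  show ?thesis
    by (rule le_modI[of "a * p" "q * b"]) (simp_all add: ab pq mult_mem mult.assoc)
qed

lemma le_mod_mult_left: "n \<in> N \<Longrightarrow> le_mod N (n * s) s"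
  by (rule le_modI[of n "s\<inverse> * s"]) (simp_all add: mem_intros mult.assoc)

lemma le_mod_sinv:
  assumes "le_mod N s t"
  shows "le_mod N (s\<inverse>) (t\<inverse>)"
proof -
  obtain a b where ab: "a \<in> N" "b \<in> N" "s = a * t * b"
    using assms by (rule le_modE)
  show ?thesis
    by (rule le_modI[of "b\<inverse>" "a\<inverse>"]) (simp_all add: ab sinv_mem mult.assoc)
qed

lemma le_mod_dom:
  assumes "le_mod N s t"
  shows "le_mod N (s * s\<inverse>) (t * t\<inverse>)"
proof -
  obtain a b where ab: "a \<in> N" "b \<in> N" "s = a * t * b"
    using assms by (rule le_modE)
  \<comment> \<open>Normality puts the conjugate \<open>t * (b * b\<inverse>) * t\<inverse>\<close>
    into \<open>N\<close>, so everything to the right of \<open>t * t\<inverse>\<close> is one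
    factor from \<open>N\<close>.\<close>
  have "s * s\<inverse> = a * (t * t\<inverse>) * ((t * (b * b\<inverse>) * t\<inverse>) * a\<inverse>)"
    by (simp add: ab mult.assoc)
  then show ?thesis
    by (rule le_modI[rotated 2]) (simp_all add: ab mem_intros)
qed

lemma le_mod_ran: "le_mod N s t \<Longrightarrow> le_mod N (s\<inverse> * s) (t\<inverse> * t)"
  using le_mod_dom[OF le_mod_sinv, of s t] by simp

text \<open>The uniqueness half of OG3. Factoring \<open>k * k\<inverse>\<close> through
  \<open>l * l\<inverse>\<close> gives \<open>k = p * l * z\<close>; in \<open>z\<close> the only
  elements from outside \<open>N\<close> are \<open>s\<inverse>\<close> and \<open>s\<close>, and
  they occur as a conjugation.\<close>

lemma le_mod_dom_cancel:
  assumes "le_mod N k s" "le_mod N l s" "le_mod N (k * k\<inverse>) (l * l\<inverse>)"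
  shows "le_mod N k l"
proof -
  obtain a b where k: "a \<in> N" "b \<in> N" "k = a * s * b"
    using assms(1) by (rule le_modE)
  obtain a' b' where l: "a' \<in> N" "b' \<in> N" "l = a' * s * b'"
    using assms(2) by (rule le_modE)
  obtain p q where pq: "p \<in> N" "q \<in> N" "k * k\<inverse> = p * (l * l\<inverse>) * q"
    using assms(3) by (rule le_modE)
  have "k = k * k\<inverse> * (a * s * b)"
    unfolding k(3)[symmetric] by (simp add: mult.assoc)
  also have "\<dots> = p * l * (l\<inverse> * q * a * s * b)"
    unfolding pq by (simp add: mult.assoc)
  also have "l\<inverse> * q * a * s * b = b'\<inverse> * (s\<inverse> * (a'\<inverse> * q * a) * s) * b"
    by (simp add: l mult.assoc)
  finally show ?thesis
    by (rule le_modI[rotated 2]) (simp_all add: k(1,2) l(1,2) pq(1,2) mem_intros)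
qed

text \<open>The existence half of OG3. If \<open>e = a * (s * s\<inverse>) * b\<close>, then
  \<open>e\<close> lies below the domain of \<open>a * s\<close>, so \<open>e * a * s\<close> has
  domain exactly \<open>e\<close>.\<close>

lemma exists_below_with_dom:
  assumes "le_mod N e (s * s\<inverse>)" "e \<in> idempotents"
  shows "\<exists>k. k * k\<inverse> = e \<and> le_mod N k s"
proof -
  obtain a b where ab: "a \<in> N" "b \<in> N" "e = a * (s * s\<inverse>) * b"
    using assms(1) by (rule le_modE)
  have e: "e * e = e"
    using assms(2) by (simp add: idempotents_def)
  have "e = a * s * (s\<inverse> * b)"
    by (simp only: ab(3) mult.assoc)
  then have "(a * s) * (a * s)\<inverse> * e = e"
    by (simp only: dom_absorb)
  then have "(e * a * s) * (e * a * s)\<inverse> = e"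
    using e by (simp add: sinv_idempotent[OF assms(2)] mult.assoc)
  moreover have "le_mod N (e * a * s) s"
    by (rule le_mod_mult_left) (simp add: ab(1) assms(2) mem_intros)
  ultimately show ?thesis
    by blast
qed

section \<open>Linking elements and the products \<open>s * a * t\<close>\<close>

definition link :: "'a \<Rightarrow> 'a \<Rightarrow> 'a \<Rightarrow> bool"
  where "link s t a \<longleftrightarrow> a \<in> N \<and> a * a\<inverse> \<preceq> s\<inverse> * s \<and> a\<inverse> * a = t * t\<inverse>"

text \<open>A factorization through \<open>s\<inverse> * s\<close> provides \<open>p\<close> in
  \<open>N\<close> such that \<open>t * t\<inverse>\<close> lies below the domain of
  \<open>p * s\<inverse>\<close>. Restricting \<open>p\<inverse>\<close> to
  \<open>s\<inverse> * s\<close> on the left and \<open>t * t\<inverse>\<close> on the right gives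
  the link.\<close>

lemma link_exists:
  assumes "le_mod N (t * t\<inverse>) (s\<inverse> * s)"
  shows "\<exists>a. link s t a"
proof -
  obtain k where k: "k * k\<inverse> = t * t\<inverse>" "le_mod N k (s\<inverse> * s)"
    using exists_below_with_dom[of "t * t\<inverse>" "s\<inverse> * s"] assms by (auto simp: mult.assoc)
  obtain p q where pq: "p \<in> N" "q \<in> N" "k = p * (s\<inverse> * s) * q"
    using k(2) by (rule le_modE)
  define a where "a = s\<inverse> * s * p\<inverse> * (t * t\<inverse>)"
  have p: "p * (s\<inverse> * (s * (p\<inverse> * (t * t\<inverse>)))) = t * t\<inverse>"
  proof -
    have "t * t\<inverse> = p * s\<inverse> * (s * q * k\<inverse>)"
      unfolding k(1)[symmetric] by (simp add: pq(3) mult.assoc)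
    then have "(p * s\<inverse>) * (p * s\<inverse>)\<inverse> * (t * t\<inverse>) = t * t\<inverse>"
      by (simp only: dom_absorb)
    then show ?thesis
      by (simp add: mult.assoc)
  qed
  have "a\<inverse> * a = t * t\<inverse>"
    by (simp add: a_def mult.assoc p)
  moreover have "a * a\<inverse> = (a * a\<inverse>) * (s\<inverse> * s)"
    by (simp add: a_def mult.assoc)
  then have "a * a\<inverse> \<preceq> s\<inverse> * s"
    unfolding natural_le_def using idempotent_mult_sinv(1) by blast
  moreover have "a \<in> N"
    by (simp add: a_def pq mem_intros)
  ultimately show ?thesis
    unfolding link_def by blast
qed

lemma link_absorb:
  assumes "link s t a"
  shows "s\<inverse> * s * a = a"
proof -
  have "s\<inverse> * s * (a * a\<inverse>) = a * a\<inverse>"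
    by (rule natural_le_idempotentD) (use assms in \<open>simp_all add: link_def\<close>)
  then show ?thesis
    by (metis mult.assoc sinv_props(1))
qed

lemma link_greatest:
  assumes "link s t a" "n \<in> N"
  shows "le_mod N (s * n * t) (s * a * t)"
proof -
  have "(s * (n * a\<inverse>) * s\<inverse>) * (s * a * t) = s * n * (a\<inverse> * (s\<inverse> * s * a)) * t"
    by (simp add: mult.assoc)
  also have "\<dots> = s * n * (t * t\<inverse>) * t"
    using assms(1) by (simp only: link_absorb[OF assms(1)] link_def)
  also have "\<dots> = s * n * t"
    by (simp add: mult.assoc)
  finally have "s * n * t = (s * (n * a\<inverse>) * s\<inverse>) * (s * a * t)"
    by simp
  moreover have "s * (n * a\<inverse>) * s\<inverse> \<in> N"
    using assms by (simp add: mem_intros link_def)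
  ultimately show ?thesis
    using le_mod_mult_left by metis
qed

text \<open>Factorizations of \<open>s\<close> and \<open>t\<close> turn \<open>s * n * t\<close>
  into \<open>u * (s' * (v * n * p) * t') * q\<close>, and maximality bounds the inner product. The
  smaller side carries an arbitrary \<open>n\<close>, so one statement serves representative
  independence, OG2 and associativity.\<close>

lemma link_mono:
  assumes "link s' t' a'" "le_mod N s s'" "le_mod N t t'" "n \<in> N"
  shows "le_mod N (s * n * t) (s' * a' * t')"
proof -
  obtain u v where uv: "u \<in> N" "v \<in> N" "s = u * s' * v"
    using assms(2) by (rule le_modE)
  obtain p q where pq: "p \<in> N" "q \<in> N" "t = p * t' * q"
    using assms(3) by (rule le_modE)
  have "le_mod N (s * n * t) (s' * (v * n * p) * t')"
    by (rule le_modI[of u q]) (simp_all add: uv pq mult.assoc)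
  moreover have "le_mod N (s' * (v * n * p) * t') (s' * a' * t')"
    by (rule link_greatest) (simp_all add: assms uv pq mem_intros)
  ultimately show ?thesis
    by (rule le_mod_trans)
qed

text \<open>An equality of elements, because \<open>a\<inverse> * a\<close> is exactly
  \<open>t * t\<inverse>\<close>; on the domain side only equivalence modulo \<open>N\<close> is
  obtained.\<close>

lemma link_ran:
  assumes "link s t a"
  shows "(s * a * t)\<inverse> * (s * a * t) = t\<inverse> * t"
proof -
  have "(s * a * t)\<inverse> * (s * a * t) = t\<inverse> * (a\<inverse> * (s\<inverse> * s * a)) * t"
    by (simp add: mult.assoc)
  also have "\<dots> = t\<inverse> * (t * t\<inverse>) * t"
    using assms by (simp add: link_absorb[OF assms]) (simp add: link_def)
  finally show ?thesis
    by (simp add: mult.assoc)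
qed

lemma le_mod_link_dom:
  assumes "link s t a"
  shows "le_mod N ((s * a * t) * (s * a * t)\<inverse>) (s * s\<inverse>)"
proof (rule le_modI)
  show "(s * a * t) * (s * a * t)\<inverse>
      = (s * (a * (t * t\<inverse>) * a\<inverse>) * s\<inverse>) * (s * s\<inverse>) * (s * s\<inverse>)"
    by (simp add: mult.assoc)
  show "s * (a * (t * t\<inverse>) * a\<inverse>) * s\<inverse> \<in> N" "s * s\<inverse> \<in> N"
    using assms by (simp_all add: link_def mem_intros)
qed

lemma link_dom:
  assumes "link s t a" "le_mod N (s\<inverse> * s) (t * t\<inverse>)"
  shows "eq_mod N ((s * a * t) * (s * a * t)\<inverse>) (s * s\<inverse>)"
proof -
  have a: "a \<in> N" "a\<inverse> * a = t * t\<inverse>" "s\<inverse> * s * a = a"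
    using assms link_absorb by (auto simp: link_def)
  have sat: "(s * a * t) * (s * a * t)\<inverse> = s * (a * a\<inverse>) * s\<inverse>"
  proof -
    have "(s * a * t) * (s * a * t)\<inverse> = s * a * (t * t\<inverse>) * a\<inverse> * s\<inverse>"
      by (simp add: mult.assoc)
    then show ?thesis
      by (simp flip: a(2) add: mult.assoc)
  qed
  obtain p q where pq: "p \<in> N" "q \<in> N" "s\<inverse> * s = p * (t * t\<inverse>) * q"
    using assms(2) by (rule le_modE)
  have a': "s\<inverse> * (s * (a * z)) = a * z" "a\<inverse> * (s\<inverse> * (s * z)) = a\<inverse> * z" for z
    using arg_cong[OF a(3), of "\<lambda>x. x * z"] arg_cong[OF a(3), of "\<lambda>x. x\<inverse> * z"]
    by (simp_all add: mult.assoc)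
  have "s * s\<inverse> = s * (s\<inverse> * s) * s\<inverse>"
    by (simp add: mult.assoc)
  \<comment> \<open>With \<open>t * t\<inverse> = a\<inverse> * a\<close>, the middle is
    \<open>(p * a\<inverse>) * (a * a\<inverse>) * (a * q)\<close>. Since
    \<open>s\<inverse> * s\<close> fixes \<open>a\<close> on the left, conjugation by
    \<open>s\<close> can be distributed over the three factors.\<close>
  also have "\<dots> = (s * (p * a\<inverse>) * s\<inverse>) * (s * (a * a\<inverse>) * s\<inverse>) * (s * (a * q) * s\<inverse>)"
    unfolding pq a(2)[symmetric] by (simp add: mult.assoc a')
  finally have "le_mod N (s * s\<inverse>) ((s * a * t) * (s * a * t)\<inverse>)"
    unfolding sat by (rule le_modI[rotated 2]) (simp_all add: mem_intros a(1) pq(1,2))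
  then show ?thesis
    using le_mod_link_dom[OF assms(1)] by (simp add: eq_mod_def)
qed

section \<open>The quotient ordered groupoid\<close>

lemma eq_mod_refl: "eq_mod N s s"
  by (simp add: eq_mod_def le_mod_refl)

lemma equiv_eq_mod: "equiv UNIV {(x, y). eq_mod N x y}"
  by (rule equivI) (auto intro!: refl_onI symI transI simp: eq_mod_def le_mod_refl
      intro: le_mod_trans)

lemma class_mod_eq_iff: "class_mod N s = class_mod N t \<longleftrightarrow> eq_mod N s t"
  unfolding class_mod_def using eq_equiv_class_iff[OF equiv_eq_mod, of s t] by simp

lemma mem_class_mod_iff: "x \<in> class_mod N s \<longleftrightarrow> eq_mod N s x"
  by (simp add: class_mod_def)

lemma class_mod_in: "class_mod N s \<in> quotient_mod N"
  unfolding class_mod_def quotient_mod_def by (rule quotientI) simp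

lemma quotient_modE:
  assumes "X \<in> quotient_mod N"
  obtains s where "X = class_mod N s"
  using assms unfolding class_mod_def quotient_mod_def by (rule quotientE)

text \<open>A union over representatives avoids choosing one; on a class it is again a class as soon
  as \<open>f\<close> respects \<open>eq_mod N\<close>.\<close>

definition map_class :: "('a \<Rightarrow> 'a) \<Rightarrow> 'a set \<Rightarrow> 'a set"
  where "map_class f X = (\<Union>x\<in>X. class_mod N (f x))"

lemma map_class_mod:
  assumes "\<And>x y. le_mod N x y \<Longrightarrow> le_mod N (f x) (f y)"
  shows "map_class f (class_mod N s) = class_mod N (f s)"
proof -
  have "class_mod N (f x) = class_mod N (f s)" if "x \<in> class_mod N s" for x
    using that assms by (auto simp: class_mod_eq_iff mem_class_mod_iff eq_mod_def)
  moreover have "s \<in> class_mod N s"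
    by (simp add: mem_class_mod_iff eq_mod_refl)
  ultimately show ?thesis
    unfolding map_class_def by blast
qed

abbreviation dom_class where "dom_class \<equiv> map_class (\<lambda>s. s * s\<inverse>)"
abbreviation ran_class where "ran_class \<equiv> map_class (\<lambda>s. s\<inverse> * s)"
abbreviation inv_class where "inv_class \<equiv> map_class sinv"

lemma dom_class_mod [simp]: "dom_class (class_mod N s) = class_mod N (s * s\<inverse>)"
  and ran_class_mod [simp]: "ran_class (class_mod N s) = class_mod N (s\<inverse> * s)"
  and inv_class_mod [simp]: "inv_class (class_mod N s) = class_mod N (s\<inverse>)"
  by (simp_all add: map_class_mod le_mod_dom le_mod_ran le_mod_sinv)

section \<open>Order and composition of classes\<close>

definition le_class :: "'a set \<Rightarrow> 'a set \<Rightarrow> bool"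
  where "le_class X Y \<longleftrightarrow> (\<exists>x\<in>X. \<exists>y\<in>Y. le_mod N x y)"

lemma le_class_mod [simp]: "le_class (class_mod N s) (class_mod N t) \<longleftrightarrow> le_mod N s t"
  unfolding le_class_def Bex_def mem_class_mod_iff eq_mod_def
  by (meson le_mod_refl le_mod_trans)

definition comp_class :: "'a set \<Rightarrow> 'a set \<Rightarrow> 'a set option"
  where "comp_class X Y =
    (if ran_class X = dom_class Y
     then Some (\<Union>{class_mod N (s * a * t) | s a t. s \<in> X \<and> t \<in> Y \<and> link s t a})
     else None)"

text \<open>Using \<open>link_mono\<close> in both directions, every choice of representatives and
  link gives an equivalent product, so the union in \<open>comp_class\<close> is over a single
  class.\<close>

lemma comp_class_mod:
  assumes "eq_mod N (s\<inverse> * s) (t * t\<inverse>)" "link s t a"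
  shows "comp_class (class_mod N s) (class_mod N t) = Some (class_mod N (s * a * t))"
proof -
  have "class_mod N (s' * a' * t') = class_mod N (s * a * t)"
    if "s' \<in> class_mod N s" "t' \<in> class_mod N t" "link s' t' a'" for s' t' a'
    using that assms(2) unfolding class_mod_eq_iff mem_class_mod_iff eq_mod_def
    by (meson link_def link_mono)
  moreover have "s \<in> class_mod N s" "t \<in> class_mod N t"
    by (simp_all add: mem_class_mod_iff eq_mod_refl)
  ultimately have "{class_mod N (s' * a' * t') | s' a' t'.
      s' \<in> class_mod N s \<and> t' \<in> class_mod N t \<and> link s' t' a'} = {class_mod N (s * a * t)}"
    using assms(2) by blast
  then show ?thesis
    using assms(1) by (simp add: comp_class_def class_mod_eq_iff)
qed

lemma comp_class_SomeE:
  assumes "comp_class (class_mod N s) (class_mod N t) = Some Z"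
  obtains a where "eq_mod N (s\<inverse> * s) (t * t\<inverse>)" "link s t a" "Z = class_mod N (s * a * t)"
proof -
  have eq: "eq_mod N (s\<inverse> * s) (t * t\<inverse>)"
    using assms by (simp add: comp_class_def class_mod_eq_iff split: if_splits)
  then obtain a where "link s t a"
    using link_exists[of t s] by (auto simp: eq_mod_def)
  then show thesis
    using that comp_class_mod[OF eq] eq assms by simp
qed

lemma comp_class_assoc:
  assumes "comp_class (class_mod N s) (class_mod N t) = Some K"
    and "comp_class (class_mod N t) (class_mod N u) = Some L"
  shows "comp_class K (class_mod N u) = comp_class (class_mod N s) L"
proof -
  obtain a where st: "eq_mod N (s\<inverse> * s) (t * t\<inverse>)" and a: "link s t a"
    and K: "K = class_mod N (s * a * t)"
    using assms(1) by (rule comp_class_SomeE)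
  obtain b where tu: "eq_mod N (t\<inverse> * t) (u * u\<inverse>)" and b: "link t u b"
    and L: "L = class_mod N (t * b * u)"
    using assms(2) by (rule comp_class_SomeE)
  have satu: "eq_mod N ((s * a * t)\<inverse> * (s * a * t)) (u * u\<inverse>)"
    unfolding link_ran[OF a] by (rule tu)
  have stbu: "eq_mod N (s\<inverse> * s) ((t * b * u) * (t * b * u)\<inverse>)"
    using st link_dom[OF b] tu unfolding eq_mod_def by (meson le_mod_trans)
  obtain c where c: "link (s * a * t) u c"
    using link_exists satu eq_mod_def by blast
  obtain e where e: "link s (t * b * u) e"
    using link_exists stbu eq_mod_def by blast
  have mem: "a \<in> N" "b \<in> N" "c \<in> N" "e \<in> N"
    using a b c e by (simp_all add: link_def)
  \<comment> \<open>Rebracketing puts \<open>a\<close> between \<open>s\<close> and an element below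
    \<open>t * b * u\<close>, so maximality for the link \<open>e\<close> bounds the product. The
    reverse bound is symmetric, with the link \<open>c\<close>.\<close>
  have "le_mod N (t * c * u) (t * b * u)"
    by (rule link_greatest[OF b mem(3)])
  then have 1: "le_mod N (s * a * (t * c * u)) (s * e * (t * b * u))"
    by (rule link_mono[OF e le_mod_refl _ mem(1)])
  have "le_mod N (s * e * t) (s * a * t)"
    by (rule link_greatest[OF a mem(4)])
  then have 2: "le_mod N ((s * e * t) * b * u) ((s * a * t) * c * u)"
    by (rule link_mono[OF c _ le_mod_refl mem(2)])
  have "eq_mod N ((s * a * t) * c * u) (s * e * (t * b * u))"
    using 1 2 by (simp add: eq_mod_def mult.assoc)
  then show ?thesis
    by (simp only: K L comp_class_mod[OF satu c] comp_class_mod[OF stbu e] class_mod_eq_iff option.inject)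
qed

text \<open>When range and domain of the representatives agree exactly, their common idempotent is
  itself a link and the composite is the class of the trace product. The right unit and inverse laws
  rest on the same choice.\<close>

lemma comp_class_dom: "comp_class (class_mod N (s * s\<inverse>)) (class_mod N s) = Some (class_mod N s)"
proof -
  have "link (s * s\<inverse>) s (s * s\<inverse>)"
    by (auto simp: link_def mem_intros mult.assoc natural_le_def
        intro!: bexI[of _ "s * s\<inverse>"])
  then show ?thesis
    using comp_class_mod[of "s * s\<inverse>" s "s * s\<inverse>"] by (simp add: mult.assoc eq_mod_refl)
qed

lemma comp_class_ran: "comp_class (class_mod N s) (class_mod N (s\<inverse> * s)) = Some (class_mod N s)"
proof -
  have "link s (s\<inverse> * s) (s\<inverse> * s)"
    by (auto simp: link_def mem_intros mult.assoc natural_le_def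
        intro!: bexI[of _ "s\<inverse> * s"])
  then show ?thesis
    using comp_class_mod[of s "s\<inverse> * s" "s\<inverse> * s"] by (simp add: mult.assoc eq_mod_refl)
qed

lemma comp_class_inv:
  "comp_class (class_mod N s) (class_mod N (s\<inverse>)) = Some (class_mod N (s * s\<inverse>))"
proof -
  have "link s (s\<inverse>) (s\<inverse> * s)"
    by (auto simp: link_def mem_intros mult.assoc natural_le_def
        intro!: bexI[of _ "s\<inverse> * s"])
  then show ?thesis
    using comp_class_mod[of s "s\<inverse>" "s\<inverse> * s"] by (simp add: mult.assoc eq_mod_refl)
qed

section \<open>Verification of the groupoid and order axioms\<close>

lemma groupoid_quotient:
  "groupoid (quotient_mod N) dom_class ran_class inv_class comp_class"
proof
  fix X assume "X \<in> quotient_mod N"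
  then obtain s where X: "X = class_mod N s"
    by (rule quotient_modE)
  show "dom_class X \<in> quotient_mod N" "ran_class X \<in> quotient_mod N"
    "inv_class X \<in> quotient_mod N"
    by (simp_all add: X class_mod_in)
  show "dom_class (dom_class X) = dom_class X" "ran_class (dom_class X) = dom_class X"
    "dom_class (ran_class X) = ran_class X" "ran_class (ran_class X) = ran_class X"
    by (simp_all add: X mult.assoc)
  show "comp_class (dom_class X) X = Some X" "comp_class X (ran_class X) = Some X"
    by (simp_all add: X comp_class_dom comp_class_ran)
  show "comp_class X (inv_class X) = Some (dom_class X)"
    "comp_class (inv_class X) X = Some (ran_class X)"
    using comp_class_inv[of s] comp_class_inv[of "s\<inverse>"] by (simp_all add: X)
next
  fix X Y assume XY: "X \<in> quotient_mod N" "Y \<in> quotient_mod N"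
  show "comp_class X Y \<noteq> None \<longleftrightarrow> ran_class X = dom_class Y"
    by (simp add: comp_class_def)
  fix Z assume Z: "comp_class X Y = Some Z"
  obtain s t where st: "X = class_mod N s" "Y = class_mod N t"
    using XY by (meson quotient_modE)
  obtain a where a: "eq_mod N (s\<inverse> * s) (t * t\<inverse>)" "link s t a" "Z = class_mod N (s * a * t)"
    using Z unfolding st by (rule comp_class_SomeE)
  have "eq_mod N ((s * a * t) * (s * a * t)\<inverse>) (s * s\<inverse>)"
    using link_dom a by (simp add: eq_mod_def)
  then show "Z \<in> quotient_mod N \<and> dom_class Z = dom_class X \<and> ran_class Z = ran_class Y"
    using link_ran[OF a(2)]
    by (simp only: a(3) st dom_class_mod ran_class_mod class_mod_in class_mod_eq_iff eq_mod_refl simp_thms)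
next
  fix X Y Z K L
  assume "X \<in> quotient_mod N" "Y \<in> quotient_mod N" "Z \<in> quotient_mod N"
    and "comp_class X Y = Some K" "comp_class Y Z = Some L"
  then show "comp_class K Z = comp_class X L"
    by (elim quotient_modE, hypsubst) (rule comp_class_assoc)
qed

lemma identities_quotient:
  "identities (quotient_mod N) dom_class = {class_mod N e | e. e \<in> idempotents}"
proof (intro set_eqI iffI)
  fix X assume "X \<in> identities (quotient_mod N) dom_class"
  then obtain s where "X = class_mod N s" "dom_class X = X"
    unfolding identities_def using quotient_modE by blast
  then have "X = class_mod N (s * s\<inverse>)"
    by simp
  then show "X \<in> {class_mod N e | e. e \<in> idempotents}"
    using idempotent_mult_sinv(1) by blast
next
  fix X assume "X \<in> {class_mod N e | e. e \<in> idempotents}"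
  then obtain e where e: "X = class_mod N e" "e \<in> idempotents"
    by blast
  then have "e * e\<inverse> = e"
    by (simp add: sinv_idempotent) (simp add: idempotents_def)
  then show "X \<in> identities (quotient_mod N) dom_class"
    by (simp add: identities_def e class_mod_in)
qed

lemma ordered_groupoid_quotient:
  "ordered_groupoid (quotient_mod N) dom_class ran_class inv_class comp_class le_class"
proof (intro ordered_groupoid.intro groupoid_quotient ordered_groupoid_axioms.intro)
  show "reflp_on (quotient_mod N) le_class"
    by (rule reflp_onI, erule quotient_modE) (simp add: le_mod_refl)
  show "antisymp_on (quotient_mod N) le_class"
    by (rule antisymp_onI, elim quotient_modE) (simp add: class_mod_eq_iff eq_mod_def)
  show "transp_on (quotient_mod N) le_class"
    by (rule transp_onI, elim quotient_modE) (auto intro: le_mod_trans)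
next
  fix X Y assume "X \<in> quotient_mod N" "Y \<in> quotient_mod N" "le_class X Y"
  then show "le_class (inv_class X) (inv_class Y)"
    by (elim quotient_modE) (simp add: le_mod_sinv)
next
  fix X1 X2 Y1 Y2 K1 K2
  assume G: "X1 \<in> quotient_mod N" "X2 \<in> quotient_mod N" "Y1 \<in> quotient_mod N" "Y2 \<in> quotient_mod N"
    and le: "le_class X1 X2" "le_class Y1 Y2"
    and comp: "comp_class X1 Y1 = Some K1" "comp_class X2 Y2 = Some K2"
  obtain s1 s2 t1 t2 where reps: "X1 = class_mod N s1" "X2 = class_mod N s2"
    "Y1 = class_mod N t1" "Y2 = class_mod N t2"
    using G by (meson quotient_modE)
  obtain a1 where a1: "link s1 t1 a1" "K1 = class_mod N (s1 * a1 * t1)"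
    using comp(1) unfolding reps by (rule comp_class_SomeE)
  obtain a2 where a2: "link s2 t2 a2" "K2 = class_mod N (s2 * a2 * t2)"
    using comp(2) unfolding reps by (rule comp_class_SomeE)
  \<comment> \<open>Here \<open>a1\<close> enters only as an element of \<open>N\<close>, while
    \<open>a2\<close> provides the maximal product above.\<close>
  show "le_class K1 K2"
    using link_mono[OF a2(1)] a1(1) le by (simp add: a1(2) a2(2) reps link_def)
next
  fix X E assume "X \<in> quotient_mod N" "E \<in> identities (quotient_mod N) dom_class"
    and le: "le_class E (dom_class X)"
  then obtain s e where reps: "X = class_mod N s" "E = class_mod N e" "e \<in> idempotents"
    by (auto simp: identities_quotient elim: quotient_modE)
  obtain k where k: "k * k\<inverse> = e" "le_mod N k s"
    using exists_below_with_dom[of e s] le reps by auto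
  show "\<exists>!K. K \<in> quotient_mod N \<and> dom_class K = E \<and> le_class K X"
  proof (rule ex1I[of _ "class_mod N k"])
    show "class_mod N k \<in> quotient_mod N \<and> dom_class (class_mod N k) = E
        \<and> le_class (class_mod N k) X"
      by (simp add: k reps class_mod_in)
  next
    fix L assume L: "L \<in> quotient_mod N \<and> dom_class L = E \<and> le_class L X"
    then obtain l where l: "L = class_mod N l"
      using quotient_modE by blast
    then have "eq_mod N (l * l\<inverse>) (k * k\<inverse>)" "le_mod N l s"
      using L by (simp_all add: reps k class_mod_eq_iff)
    \<comment> \<open>Both \<open>l\<close> and \<open>k\<close> lie below \<open>s\<close> and have
      equivalent domains, so cancellation applies in each direction.\<close>
    then show "L = class_mod N k"
      using k(2) le_mod_dom_cancel[of l s k] le_mod_dom_cancel[of k s l]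
      by (simp add: l class_mod_eq_iff eq_mod_def)
  qed
qed

section \<open>Identities and Green's relation\<close>

text \<open>The preorder is two-sided divisibility by \<open>N\<close>. Since \<open>N\<close>
  contains all idempotents, \<open>x * x\<inverse>\<close> and \<open>x\<inverse> * x\<close> supply
  the missing factors in the trivial and one-sided terms of the ideal.\<close>

lemma principal_ideal_eq: "principal_ideal N x = {z. le_mod N z x}"
proof (intro set_eqI iffI)
  fix z assume "z \<in> principal_ideal N x"
  moreover have "le_mod N (x * n) x" if "n \<in> N" for n
    by (rule le_modI[of "x * x\<inverse>" n]) (simp_all add: that mem_intros mult.assoc)
  ultimately show "z \<in> {z. le_mod N z x}"
    unfolding principal_ideal_def
    using le_mod_refl le_mod_mult_left le_modI by blast
next
  fix z assume "z \<in> {z. le_mod N z x}"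
  then show "z \<in> principal_ideal N x"
    by (auto simp: le_mod_iff principal_ideal_def)
qed

lemma principal_ideal_subset_iff:
  "principal_ideal N x \<subseteq> principal_ideal N y \<longleftrightarrow> le_mod N x y"
  unfolding principal_ideal_eq using le_mod_refl le_mod_trans by blast

text \<open>A factorization \<open>y = a * x * b\<close> with factors in \<open>N\<close> keeps the
  whole class inside \<open>N\<close>, so confining Green's relation to \<open>N\<close> removes no
  element.\<close>

lemma green_J_class:
  assumes "x \<in> N"
  shows "green_J N `` {x} = class_mod N x"
proof -
  have "y \<in> N" if "eq_mod N x y" for y
    using that assms le_modE[of y x] mult_mem unfolding eq_mod_def by metis
  moreover have "principal_ideal N x = principal_ideal N y \<longleftrightarrow> eq_mod N x y" for y
    by (simp add: set_eq_subset principal_ideal_subset_iff eq_mod_def)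
  ultimately show ?thesis
    using assms unfolding green_J_def by (intro set_eqI) (simp add: mem_class_mod_iff, blast)
qed

text \<open>Within \<open>N\<close>, \<open>n\<close> and \<open>n * n\<inverse>\<close> are
  multiples of each other; hence every J-class of \<open>N\<close> contains an idempotent.\<close>

lemma eq_mod_dom:
  assumes "n \<in> N"
  shows "eq_mod N n (n * n\<inverse>)"
  unfolding eq_mod_def
  by (intro conjI le_modI[of "n * n\<inverse>" n] le_modI[of "n * n\<inverse>" "n\<inverse>"])
    (simp_all add: assms mem_intros mult.assoc)

lemma identities_eq_green_J: "identities (quotient_mod N) dom_class = N // green_J N"
proof (intro set_eqI iffI)
  fix X assume "X \<in> identities (quotient_mod N) dom_class"
  then obtain e where "X = class_mod N e" "e \<in> N"
    by (auto simp: identities_quotient idempotent_mem)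
  then show "X \<in> N // green_J N"
    by (metis green_J_class quotientI)
next
  fix X assume "X \<in> N // green_J N"
  then obtain n where n: "n \<in> N" "X = green_J N `` {n}"
    by (rule quotientE)
  then have "X = class_mod N (n * n\<inverse>)"
    using eq_mod_dom by (simp add: green_J_class class_mod_eq_iff)
  then show "X \<in> identities (quotient_mod N) dom_class"
    unfolding identities_quotient using idempotent_mult_sinv(1) by blast
qed

lemma le_class_iff_J_class_le:
  assumes "X \<in> N // green_J N" "Y \<in> N // green_J N"
  shows "le_class X Y \<longleftrightarrow> J_class_le N X Y"
proof -
  obtain x y where x: "x \<in> N" "X = green_J N `` {x}" and y: "y \<in> N" "Y = green_J N `` {y}"
    using assms by (meson quotientE)
  \<comment> \<open>All members of a J-class generate the same ideal, so one representative on each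
    side decides the order.\<close>
  have "J_class_le N X Y \<longleftrightarrow> principal_ideal N x \<subseteq> principal_ideal N y"
    using x y by (auto simp: J_class_le_def green_J_def)
  then show ?thesis
    using x y by (simp add: green_J_class principal_ideal_subset_iff)
qed

end

theorem theorem2p6:
  fixes N :: "'a::inverse_semigroup set"
  assumes "normal_inverse_subsemigroup N"
  shows "\<exists>d r i c le.
    ordered_groupoid (quotient_mod N) d r i c le \<and>
    \<comment> \<open>(a)\<close>
    identities (quotient_mod N) d = {class_mod N e | e. e \<in> idempotents} \<and>
    (\<forall>s. d (class_mod N s) = class_mod N (s * s\<inverse>) \<and>
         r (class_mod N s) = class_mod N (s\<inverse> * s) \<and>
         i (class_mod N s) = class_mod N (s\<inverse>)) \<and>
    \<comment> \<open>(b)\<close>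
    (\<exists>\<phi>. bij_betw \<phi> (identities (quotient_mod N) d) (N // green_J N) \<and>
         (\<forall>x \<in> identities (quotient_mod N) d. \<forall>y \<in> identities (quotient_mod N) d.
            le x y \<longleftrightarrow> J_class_le N (\<phi> x) (\<phi> y))) \<and>
    \<comment> \<open>(c)\<close>
    (\<forall>s t. eq_mod N (s\<inverse> * s) (t * t\<inverse>) \<longrightarrow>
       (\<exists>a \<in> N. a * a\<inverse> \<preceq> s\<inverse> * s \<and> a\<inverse> * a = t * t\<inverse>) \<and>
       (\<forall>a \<in> N. a * a\<inverse> \<preceq> s\<inverse> * s \<and> a\<inverse> * a = t * t\<inverse> \<longrightarrow>
          c (class_mod N s) (class_mod N t) = Some (class_mod N (s * a * t)))) \<and>
    \<comment> \<open>(d)\<close>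
    (\<forall>s t. le (class_mod N s) (class_mod N t) \<longleftrightarrow>
       (\<exists>a \<in> N. \<exists>b \<in> N. trace_defined a s \<and> trace_defined s b \<and> a * s * b \<preceq> t))"
proof -
  interpret normal_subsemigroup N
    by standard (rule assms)
  have b: "\<exists>\<phi>. bij_betw \<phi> (identities (quotient_mod N) dom_class) (N // green_J N) \<and>
      (\<forall>x \<in> identities (quotient_mod N) dom_class. \<forall>y \<in> identities (quotient_mod N) dom_class.
        le_class x y \<longleftrightarrow> J_class_le N (\<phi> x) (\<phi> y))"
    \<comment> \<open>Identities and J-classes are the same sets, so the identity map is the
      isomorphism.\<close>
    unfolding identities_eq_green_J
    by (rule exI[of _ id]) (simp add: le_class_iff_J_class_le)
  have c: "\<forall>s t. eq_mod N (s\<inverse> * s) (t * t\<inverse>) \<longrightarrow>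
      (\<exists>a \<in> N. a * a\<inverse> \<preceq> s\<inverse> * s \<and> a\<inverse> * a = t * t\<inverse>) \<and>
      (\<forall>a \<in> N. a * a\<inverse> \<preceq> s\<inverse> * s \<and> a\<inverse> * a = t * t\<inverse> \<longrightarrow>
        comp_class (class_mod N s) (class_mod N t) = Some (class_mod N (s * a * t)))"
    using link_exists comp_class_mod unfolding link_def eq_mod_def by blast
  show ?thesis
    by (intro exI[of _ dom_class] exI[of _ ran_class] exI[of _ inv_class]
        exI[of _ comp_class] exI[of _ le_class] conjI ordered_groupoid_quotient
        identities_quotient b c)
      (simp_all add: le_mod_def)
qed

end
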